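(* Let $\Gamma=(V,E)$ be a finite connected vertex-transitive graph and let $n$ be an integer with $2\leq n\leq |V|-1$. Then \[ h_{n}(\Gamma)\geq \frac{h_{n+1}(\Gamma)}{10n+h_{n+1}(\Gamma)} \quad \text{and} \quad \iota_{n}(\Gamma)\geq \frac{2\iota_{n+1}(\Gamma)}{20n+\iota_{n+1}(\Gamma)}. \] In particular, $\iota_{n+1}(\Gamma)\leq (11n+1)\iota_n(\Gamma)$.
   Context: All graphs are finite, undirected, regular, without multiple edges or self-loops. For disjoint $A,B\subseteq V$, $\partial(A,B)$ is the set of edges with one endpoint in $A$ and the other in $B$, and $\partial A=\partial(A,V\setminus A)$. The symmetric vertex boundary $\delta(A,B)$ is the set of vertices $u\in A$ incident to an edge of $\partial(A,B)$ together with the vertices $v\in B$ incident to an edge of $\partial(A,B)$; $\delta A=\delta(A,V\setminus A)$. For $2\leq n\leq |V|$, the $n$-way isoperimetric constant is $h_n(\Gamma)=\min\max_{1\leq i\leq n}|\partial A_i|/|A_i|$ and the $n$-way symmetric vertex isoperimetric constant is $\iota_n(\Gamma)=\min\max_{1\leq i\leq n}|\delta A_i|/|A_i|$, where in both cases the minimum is over all partitions $V=A_1\sqcup\cdots\sqcup A_n$ into $n$ non-empty pairwise disjoint subsets. *)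

theory Defs
  imports Complex_Main "HOL-Library.Disjoint_Sets"
begin

text \<open>
  A graph is given by a vertex set \<open>V\<close> and a set \<open>E\<close> of unordered edges, each edge
  being a two-element subset of \<open>V\<close>; this excludes loops and multiple edges.
\<close>

definition simple_graph :: "'a set \<Rightarrow> 'a set set \<Rightarrow> bool" where
  "simple_graph V E \<longleftrightarrow> finite V \<and> (\<forall>e\<in>E. e \<subseteq> V \<and> card e = 2)"

definition vertex_degree :: "'a set set \<Rightarrow> 'a \<Rightarrow> nat" where
  "vertex_degree E v = card {e \<in> E. v \<in> e}"

definition regular_graph :: "'a set \<Rightarrow> 'a set set \<Rightarrow> bool" where
  "regular_graph V E \<longleftrightarrow> (\<exists>d. \<forall>v\<in>V. vertex_degree E v = d)"

definition connected_graph :: "'a set \<Rightarrow> 'a set set \<Rightarrow> bool" where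
  "connected_graph V E \<longleftrightarrow> V \<noteq> {} \<and> (\<forall>u\<in>V. \<forall>v\<in>V. (u, v) \<in> {(x, y). {x, y} \<in> E}\<^sup>*)"

definition graph_automorphism :: "'a set \<Rightarrow> 'a set set \<Rightarrow> ('a \<Rightarrow> 'a) \<Rightarrow> bool" where
  "graph_automorphism V E f \<longleftrightarrow>
     bij_betw f V V \<and> (\<forall>u\<in>V. \<forall>v\<in>V. {u, v} \<in> E \<longleftrightarrow> {f u, f v} \<in> E)"

definition vertex_transitive :: "'a set \<Rightarrow> 'a set set \<Rightarrow> bool" where
  "vertex_transitive V E \<longleftrightarrow> (\<forall>u\<in>V. \<forall>v\<in>V. \<exists>f. graph_automorphism V E f \<and> f u = v)"

definition edge_boundary_between :: "'a set set \<Rightarrow> 'a set \<Rightarrow> 'a set \<Rightarrow> 'a set set" where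
  "edge_boundary_between E A B = {e \<in> E. \<exists>u\<in>A. \<exists>v\<in>B. e = {u, v}}"

definition edge_boundary :: "'a set \<Rightarrow> 'a set set \<Rightarrow> 'a set \<Rightarrow> 'a set set" where
  "edge_boundary V E A = edge_boundary_between E A (V - A)"

definition sym_vertex_boundary_between :: "'a set set \<Rightarrow> 'a set \<Rightarrow> 'a set \<Rightarrow> 'a set" where
  "sym_vertex_boundary_between E A B =
     {u \<in> A. \<exists>e\<in>edge_boundary_between E A B. u \<in> e} \<union>
     {v \<in> B. \<exists>e\<in>edge_boundary_between E A B. v \<in> e}"

definition sym_vertex_boundary :: "'a set \<Rightarrow> 'a set set \<Rightarrow> 'a set \<Rightarrow> 'a set" where
  "sym_vertex_boundary V E A = sym_vertex_boundary_between E A (V - A)"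

text \<open>
  The parts \<open>A\<^sub>1, \<dots>, A\<^sub>n\<close> of a partition are taken as an unordered set \<open>P\<close> of \<open>n\<close> blocks;
  they are non-empty and disjoint, hence distinct, so this loses nothing. For finite \<open>V\<close>
  and \<open>1 \<le> n \<le> card V\<close>, both \<open>Min\<close> and \<open>Max\<close> below range over finite non-empty sets;
  outside that range of \<open>n\<close> the constants are unspecified.
\<close>

definition n_partitions :: "'a set \<Rightarrow> nat \<Rightarrow> 'a set set set" where
  "n_partitions V n = {P. partition_on V P \<and> card P = n}"

definition edge_isoperimetric :: "'a set \<Rightarrow> 'a set set \<Rightarrow> nat \<Rightarrow> real" where
  "edge_isoperimetric V E n =
     Min ((\<lambda>P. Max ((\<lambda>A. real (card (edge_boundary V E A)) / real (card A)) ` P))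
          ` n_partitions V n)"

definition vertex_isoperimetric :: "'a set \<Rightarrow> 'a set set \<Rightarrow> nat \<Rightarrow> real" where
  "vertex_isoperimetric V E n =
     Min ((\<lambda>P. Max ((\<lambda>A. real (card (sym_vertex_boundary V E A)) / real (card A)) ` P))
          ` n_partitions V n)"

end

theory Submission
  imports Defs
begin

text \<open>
  Let \<open>A\<^sub>1, \<dots>, A\<^sub>n\<close> be an optimal partition with \<open>A\<^sub>1\<close> smallest, \<open>h\<close> its constant, and let
  \<open>\<lambda> = 1\<close> for edge boundaries, \<open>\<lambda> = 2\<close> for symmetric vertex boundaries. Only \<open>h < \<lambda>\<close>
  matters; put \<open>c = (1 - h / \<lambda>) / (5n)\<close>. If some automorphism \<open>g\<close> leaves at least
  \<open>c |A\<^sub>j|\<close> vertices of every \<open>A\<^sub>j\<close> outside \<open>g A\<^sub>1\<close>, then \<open>g A\<^sub>1\<close> together with the sets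
  \<open>A\<^sub>j - g A\<^sub>1\<close> is a partition into \<open>n + 1\<close> parts with constant at most \<open>2h / c\<close>, which is the
  claim. Otherwise every translate of \<open>A\<^sub>1\<close> nearly coincides with one of the \<open>A\<^sub>j\<close>, so the
  translates fall into at most \<open>n\<close> clusters, which are permuted by the automorphisms. Majority
  votes inside the clusters yield a genuine system of imprimitivity whose blocks are close to
  parts \<open>A\<^sub>j\<close>. The edges between different blocks form a regular graph of positive degree, so
  some \<open>A\<^sub>j\<close> has inner and outer boundary both larger than \<open>(h / \<lambda>) |A\<^sub>j|\<close>, a contradiction.
  The last inequality also needs \<open>\<iota>\<^sub>n \<le> 2n\<close>, which a balanced partition shows.
\<close>

section \<open>Double counting in finite sets\<close>

lemma card_Collect_bij_betw:
  assumes "bij_betw f A B" and "\<And>x. x \<in> A \<Longrightarrow> Q (f x) \<longleftrightarrow> P x"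
  shows "card {y \<in> B. Q y} = card {x \<in> A. P x}"
proof -
  have "bij_betw f {x \<in> A. P x} {y \<in> B. Q y}"
    using assms unfolding bij_betw_def inj_on_def by auto
  then show ?thesis by (simp add: bij_betw_same_card)
qed

lemma sum_card_Collect_swap:
  assumes "finite A" "finite B"
  shows "(\<Sum>x\<in>A. card {y \<in> B. R x y}) = (\<Sum>y\<in>B. card {x \<in> A. R x y})"
  using assms by (intro sum_multicount_gen) auto

text \<open>Count the pairs of \<open>Q\<close> in two ways: every \<open>x\<close> supplies at
  least half of \<open>C\<close>, every \<open>T\<close> accounts for at most \<open>t\<close> of
  them. This converts majority votes into size bounds at the cost of a factor 2.\<close>

lemma card_le_double_average:
  fixes t :: real
  assumes "finite X" "finite C" "C \<noteq> {}"
    and many: "\<And>x. x \<in> X \<Longrightarrow> card C \<le> 2 * card {T \<in> C. Q x T}"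
    and few: "\<And>T. T \<in> C \<Longrightarrow> real (card {x \<in> X. Q x T}) \<le> t"
  shows "real (card X) \<le> 2 * t"
proof -
  have "card X * card C = (\<Sum>x\<in>X. card C)" by simp
  also have "\<dots> \<le> (\<Sum>x\<in>X. 2 * card {T \<in> C. Q x T})" by (rule sum_mono) (rule many)
  also have "\<dots> = 2 * (\<Sum>T\<in>C. card {x \<in> X. Q x T})"
    using sum_card_Collect_swap[OF assms(1,2), of Q] by (simp only: sum_distrib_left[symmetric])
  finally have "real (card X * card C) \<le> real (2 * (\<Sum>T\<in>C. card {x \<in> X. Q x T}))"
    by (rule of_nat_mono)
  also have "\<dots> = 2 * (\<Sum>T\<in>C. real (card {x \<in> X. Q x T}))" by simp
  also have "\<dots> \<le> 2 * (\<Sum>T\<in>C. t)" by (intro mult_left_mono sum_mono few) auto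
  also have "\<dots> = (2 * t) * card C" by simp
  finally have "real (card X) * card C \<le> (2 * t) * card C" by simp
  moreover have "card C > 0" using assms(2,3) by (simp add: card_gt_0_iff)
  ultimately show ?thesis by simp
qed

text \<open>Exactly \<open>k * card S\<close> related pairs start in \<open>S\<close>, and each
  neighbour absorbs at most \<open>k\<close> of them.\<close>

lemma card_le_card_regular_neighbours:
  assumes "finite V" "S \<subseteq> V" "k > 0"
    and sym: "\<And>x y. R x y \<Longrightarrow> R y x"
    and reg: "\<And>x. x \<in> V \<Longrightarrow> card {y \<in> V. R x y} = k"
  shows "card S \<le> card {y \<in> V. \<exists>x\<in>S. R x y}"
proof -
  let ?N = "{y \<in> V. \<exists>x\<in>S. R x y}"
  have fin: "finite S" "finite ?N" using assms(1,2) finite_subset by auto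
  have "card S * k = (\<Sum>x\<in>S. card {y \<in> V. R x y})" using assms(2) reg by (simp add: subset_iff)
  also have "\<dots> = (\<Sum>x\<in>S. card {y \<in> ?N. R x y})"
    by (intro sum.cong refl arg_cong[where f=card]) auto
  also have "\<dots> = (\<Sum>y\<in>?N. card {x \<in> S. R x y})" by (rule sum_card_Collect_swap[OF fin])
  also have "\<dots> \<le> (\<Sum>y\<in>?N. k)"
  proof (rule sum_mono)
    fix y assume y: "y \<in> ?N"
    have "{x \<in> S. R x y} \<subseteq> {x \<in> V. R y x}" using assms(2) sym by auto
    then have "card {x \<in> S. R x y} \<le> card {x \<in> V. R y x}"
      using assms(1) by (intro card_mono) auto
    then show "card {x \<in> S. R x y} \<le> k" using reg y by auto
  qed
  finally show ?thesis using assms(3) by simp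
qed

section \<open>Vertex boundaries and automorphisms of a transitive graph\<close>

definition inner_boundary :: "'a set \<Rightarrow> 'a set set \<Rightarrow> 'a set \<Rightarrow> 'a set" where
  "inner_boundary V E A = {u \<in> A. \<exists>v\<in>V - A. {u, v} \<in> E}"

definition outer_boundary :: "'a set \<Rightarrow> 'a set set \<Rightarrow> 'a set \<Rightarrow> 'a set" where
  "outer_boundary V E A = {v \<in> V - A. \<exists>u\<in>A. {u, v} \<in> E}"

locale transitive_graph =
  fixes V :: "'a set" and E :: "'a set set"
  assumes simple: "simple_graph V E"
    and connected: "connected_graph V E"
    and transitive: "vertex_transitive V E"
begin

abbreviation aut :: "('a \<Rightarrow> 'a) \<Rightarrow> bool" where
  "aut \<equiv> graph_automorphism V E"

lemma finite_V: "finite V" using simple by (simp add: simple_graph_def)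

lemma edge_in_V: "{u, v} \<in> E \<Longrightarrow> u \<in> V \<and> v \<in> V"
  using simple by (auto simp: simple_graph_def)

lemma aut_id: "aut id" by (simp add: graph_automorphism_def)

lemma aut_bij: "aut g \<Longrightarrow> bij_betw g V V" by (simp add: graph_automorphism_def)

lemma aut_inj_on: "aut g \<Longrightarrow> A \<subseteq> V \<Longrightarrow> inj_on g A"
  using aut_bij bij_betw_def inj_on_subset by metis

lemma aut_in_V: "aut g \<Longrightarrow> x \<in> V \<Longrightarrow> g x \<in> V"
  using aut_bij bij_betwE by fast

lemma aut_edge: "aut g \<Longrightarrow> x \<in> V \<Longrightarrow> y \<in> V \<Longrightarrow> {g x, g y} \<in> E \<longleftrightarrow> {x, y} \<in> E"
  by (simp add: graph_automorphism_def)

lemma aut_comp: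
  assumes "aut g" "aut h"
  shows "aut (g \<circ> h)"
  unfolding graph_automorphism_def
  using aut_bij[OF assms(2)] aut_bij[OF assms(1)] aut_in_V[OF assms(2)]
  by (auto simp: aut_edge[OF assms(1)] aut_edge[OF assms(2)] intro: bij_betw_trans)

lemma aut_card_image: "aut g \<Longrightarrow> A \<subseteq> V \<Longrightarrow> card (g ` A) = card A"
  by (simp add: aut_inj_on card_image)

lemma aut_mem_image: "aut g \<Longrightarrow> A \<subseteq> V \<Longrightarrow> x \<in> V \<Longrightarrow> g x \<in> g ` A \<longleftrightarrow> x \<in> A"
  using aut_inj_on[of g V] by (simp add: inj_on_image_mem_iff)

lemma aut_image_Compl: "aut g \<Longrightarrow> A \<subseteq> V \<Longrightarrow> V - g ` A = g ` (V - A)"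
  using aut_inj_on[of g V] aut_bij[of g] inj_on_image_set_diff[of g V V A]
  by (simp add: bij_betw_def)

lemma aut_moves:
  assumes "x \<in> V" "y \<in> V"
  obtains g where "aut g" "g x = y"
proof -
  have "\<exists>g. aut g \<and> g x = y" using transitive assms by (simp add: vertex_transitive_def)
  then show thesis by (elim exE conjE) (rule that)
qed

lemma inner_boundary_aut:
  assumes "aut g" "A \<subseteq> V"
  shows "inner_boundary V E (g ` A) = g ` inner_boundary V E A"
  unfolding inner_boundary_def aut_image_Compl[OF assms]
  using assms(2) by (fastforce simp: aut_edge[OF assms(1)] subset_iff)

lemma outer_boundary_aut:
  assumes "aut g" "A \<subseteq> V"
  shows "outer_boundary V E (g ` A) = g ` outer_boundary V E A"
  unfolding outer_boundary_def aut_image_Compl[OF assms]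
  using assms(2) by (fastforce simp: aut_edge[OF assms(1)] subset_iff)

lemma edge_leaving:
  assumes "B \<subseteq> V" "B \<noteq> {}" "B \<noteq> V"
  shows "\<exists>u\<in>B. \<exists>v\<in>V - B. {u, v} \<in> E"
proof (rule ccontr)
  assume stay: "\<not> ?thesis"
  obtain x y where x: "x \<in> B" and y: "y \<in> V" "y \<notin> B" using assms by auto
  have "(x, y) \<in> {(x, y). {x, y} \<in> E}\<^sup>*"
    using connected assms(1) x y by (auto simp: connected_graph_def)
  then have "y \<in> B"
  proof (induction rule: rtrancl_induct)
    case base show ?case by (rule x)
  next
    case (step u v) then show ?case using stay edge_in_V by blast
  qed
  then show False using y by simp
qed

end

section \<open>Translates of the smallest part and the parts nearest to them\<close>

text \<open>The case in which no translate of \<open>A1\<close> can be split off. The bound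
  \<open>c_small\<close> keeps the errors small even after summation over all parts.\<close>

locale rigid_partition = transitive_graph +
  fixes P :: "'a set set" and A1 :: "'a set" and c :: real
  assumes part: "partition_on V P"
    and A1: "A1 \<in> P"
    and smallest: "A \<in> P \<Longrightarrow> card A1 \<le> card A"
    and two_parts: "2 \<le> card P"
    and c_pos: "0 < c"
    and c_small: "5 * c * card P \<le> 1"
    and rigid: "aut g \<Longrightarrow> \<exists>A\<in>P. card (A - g ` A1) < c * card A"
begin

lemma part_subset: "A \<in> P \<Longrightarrow> A \<subseteq> V"
  using part by (auto simp: partition_on_def)

lemma part_finite: "A \<in> P \<Longrightarrow> finite A"
  using part_subset finite_V finite_subset by blast

lemma part_disjoint: "A \<in> P \<Longrightarrow> A' \<in> P \<Longrightarrow> A \<noteq> A' \<Longrightarrow> A \<inter> A' = {}"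
  using part by (auto simp: partition_on_def disjoint_def)

lemma P_finite: "finite P"
  using finite_V part finite_elements by blast

lemma A1_card_pos: "0 < card A1"
proof -
  have "A1 \<noteq> {}" using A1 part by (auto simp: partition_on_def)
  then show ?thesis using part_finite[OF A1] by (simp add: card_gt_0_iff)
qed

lemma c_le: "c \<le> 1 / 10"
proof -
  have "5 * c * 2 \<le> 5 * c * card P" using c_pos two_parts by (intro mult_left_mono) auto
  then show ?thesis using c_small by simp
qed

lemma card_V_ge: "card P * card A1 \<le> card V"
proof -
  have "card P * card A1 = (\<Sum>A\<in>P. card A1)" by simp
  also have "\<dots> \<le> (\<Sum>A\<in>P. card A)" by (rule sum_mono) (rule smallest)
  also have "\<dots> = card (\<Union>P)"
    using part part_finite by (intro card_Union_disjoint[symmetric])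
      (auto simp: partition_on_def disjoint_def pairwise_def disjnt_def)
  also have "\<dots> = card V" using part by (simp add: partition_on_def)
  finally show ?thesis .
qed

definition translates :: "'a set set" where
  "translates = {g ` A1 | g. aut g}"

lemma translate_subset: "T \<in> translates \<Longrightarrow> T \<subseteq> V"
  using aut_in_V part_subset[OF A1] by (auto simp: translates_def)

lemma translate_finite: "T \<in> translates \<Longrightarrow> finite T"
  using translate_subset finite_V finite_subset by blast

lemma translates_finite: "finite translates"
  using translate_subset finite_V by (intro finite_subset[of translates "Pow V"]) auto

lemma translate_card: "T \<in> translates \<Longrightarrow> card T = card A1"
  using aut_card_image part_subset[OF A1] by (auto simp: translates_def)

lemma A1_translate: "A1 \<in> translates"
  using aut_id unfolding translates_def by (metis (mono_tags, lifting) image_id id_apply mem_Collect_eq)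

lemma aut_translate: "aut g \<Longrightarrow> T \<in> translates \<Longrightarrow> g ` T \<in> translates"
  unfolding translates_def by (smt (verit, best) aut_comp image_comp mem_Collect_eq)

lemma translates_transitive:
  assumes "T \<in> translates" "T' \<in> translates"
  shows "\<exists>g. aut g \<and> g ` T = T'"
proof -
  obtain h h' where h: "aut h" "T = h ` A1" and h': "aut h'" "T' = h' ` A1"
    using assms by (auto simp: translates_def)
  \<comment> \<open>The required automorphism is \<open>h'\<close> after the inverse of
    \<open>h\<close>. Inverting on \<open>V\<close> alone suffices, since \<open>aut\<close>
    constrains a map only there.\<close>
  have bij: "bij_betw (inv_into V h) V V" using h aut_bij by (simp add: bij_betw_inv_into)
  have right: "h (inv_into V h x) = x" if "x \<in> V" for x
    using that aut_bij[OF h(1)] by (simp add: bij_betw_inv_into_right)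
  have left: "inv_into V h (h x) = x" if "x \<in> V" for x
    using that aut_bij[OF h(1)] by (simp add: bij_betw_inv_into_left)
  have "aut (inv_into V h)"
    unfolding graph_automorphism_def
    using bij bij_betwE[OF bij] right aut_edge[OF h(1)] by (metis (no_types, lifting))
  moreover have "(h' \<circ> inv_into V h) ` T = T'"
    using h(2) h'(2) left part_subset[OF A1] by (force simp: image_iff subset_iff)
  ultimately show ?thesis using h'(1) aut_comp by blast
qed

lemma aut_bij_translates:
  assumes "aut g"
  shows "bij_betw ((`) g) translates translates"
proof -
  have inj: "inj_on ((`) g) translates"
    using aut_inj_on[OF assms, of V] translate_subset
    by (meson inj_on_image_eq_iff inj_onI order_refl)
  moreover have "(`) g ` translates \<subseteq> translates" using assms aut_translate by auto
  ultimately show ?thesis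
    using translates_finite by (simp add: bij_betw_def endo_inj_surj)
qed

text \<open>\<open>rigid\<close> provides such a part for every translate; on other sets the value
  is arbitrary.\<close>

definition nearest :: "'a set \<Rightarrow> 'a set" where
  "nearest T = (SOME A. A \<in> P \<and> card (A - T) < c * card A)"

lemma nearest:
  assumes "T \<in> translates"
  shows "nearest T \<in> P" and "card (nearest T - T) < c * card (nearest T)"
proof -
  have "\<exists>A. A \<in> P \<and> card (A - T) < c * card A"
    using assms rigid by (auto simp: translates_def)
  from someI_ex[OF this] show "nearest T \<in> P" "card (nearest T - T) < c * card (nearest T)"
    by (auto simp: nearest_def)
qed

text \<open>Minimality of \<open>A1\<close> reverses the estimate: with
  \<open>A = nearest T\<close>, |T - A| = |A1| - |A| + |A - T| < |A1| - (1 - c)|A|, and |A| is at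
  least |A1|.\<close>

lemma card_diff_nearest:
  assumes "T \<in> translates"
  shows "card (T - nearest T) < c * card A1"
proof -
  let ?A = "nearest T"
  have fin: "finite T" "finite ?A" using assms translate_finite part_finite nearest by auto
  have "card T = card (T - ?A) + card (T \<inter> ?A)" "card ?A = card (?A - T) + card (T \<inter> ?A)"
    using card_Int_Diff[OF fin(1), of ?A] card_Int_Diff[OF fin(2), of T] by (simp_all add: Int_commute)
  then have eq: "real (card (T - ?A)) = real (card A1) - real (card ?A) + real (card (?A - T))"
    using translate_card[OF assms] by linarith
  have "(1 - c) * card A1 \<le> (1 - c) * card ?A"
    using smallest nearest(1)[OF assms] c_le by (intro mult_left_mono) auto
  then show ?thesis using eq nearest(2)[OF assms] by (simp add: algebra_simps)
qed

section \<open>Clusters of translates and their majority blocks\<close>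

text \<open>Overlap in more than half the size is visibly invariant under automorphisms, whereas
  \<open>nearest\<close> depends on the partition.\<close>

definition close :: "'a set \<Rightarrow> 'a set \<Rightarrow> bool" where
  "close T T' \<longleftrightarrow> card A1 < 2 * card (T \<inter> T')"

text \<open>Two translates that each miss less than a fraction \<open>c\<close> of the same part
  share more than (1 - 2c) of it, at least half of |A1|. If the parts differ, they are disjoint, and
  the overlap lies in two exceptional sets of size below c|A1| each. Hence closeness is an
  equivalence relation with at most \<open>card P\<close> classes.\<close>

lemma close_iff_nearest:
  assumes "T \<in> translates" "T' \<in> translates"
  shows "close T T' \<longleftrightarrow> nearest T = nearest T'"
proof
  assume same: "nearest T = nearest T'"
  let ?A = "nearest T"
  have fin: "finite ?A" "finite T" using assms translate_finite part_finite nearest by auto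
  have "?A \<subseteq> (T \<inter> T') \<union> (?A - T) \<union> (?A - T')" by auto
  then have "card ?A \<le> card ((T \<inter> T') \<union> (?A - T) \<union> (?A - T'))" using fin by (intro card_mono) auto
  also have "\<dots> \<le> card (T \<inter> T') + card (?A - T) + card (?A - T')"
    by (meson add_mono card_Un_le le_trans order_refl)
  finally have "real (card ?A) \<le> card (T \<inter> T') + real (card (?A - T)) + card (?A - T')" by linarith
  then have "(1 - 2 * c) * card ?A < card (T \<inter> T')"
    using nearest(2)[OF assms(1)] nearest(2)[OF assms(2)] same by (simp add: algebra_simps)
  moreover have "(1 / 2) * real (card A1) \<le> (1 - 2 * c) * card ?A"
    using smallest nearest(1)[OF assms(1)] c_le by (intro mult_mono) auto
  ultimately show "close T T'" unfolding close_def by linarith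
next
  assume cl: "close T T'"
  show "nearest T = nearest T'"
  proof (rule ccontr)
    assume "nearest T \<noteq> nearest T'"
    then have "nearest T \<inter> nearest T' = {}" using assms nearest(1) part_disjoint by simp
    then have "T \<inter> T' \<subseteq> (T - nearest T) \<union> (T' - nearest T')" by auto
    then have "card (T \<inter> T') \<le> card ((T - nearest T) \<union> (T' - nearest T'))"
      using assms translate_finite by (intro card_mono) auto
    also have "\<dots> \<le> card (T - nearest T) + card (T' - nearest T')" by (rule card_Un_le)
    finally have "real (card (T \<inter> T')) < 2 * c * card A1"
      using card_diff_nearest[OF assms(1)] card_diff_nearest[OF assms(2)] by linarith
    also have "\<dots> \<le> (1 / 2) * card A1" using c_le by (intro mult_right_mono) auto
    finally show False using cl unfolding close_def by linarith
  qed
qed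

lemma close_aut:
  assumes "aut g" "T \<in> translates" "T' \<in> translates"
  shows "close (g ` T) (g ` T') \<longleftrightarrow> close T T'"
proof -
  have "g ` T \<inter> g ` T' = g ` (T \<inter> T')"
    using aut_inj_on[OF assms(1), of V] translate_subset assms(2,3)
    by (metis inj_on_image_Int order_refl)
  moreover have "card (g ` (T \<inter> T')) = card (T \<inter> T')"
    using assms(1,2) translate_subset by (intro aut_card_image) auto
  ultimately show ?thesis by (simp add: close_def)
qed

definition cluster :: "'a set \<Rightarrow> 'a set set" where
  "cluster T = {T' \<in> translates. close T T'}"

lemma cluster_nearest: "T \<in> translates \<Longrightarrow> cluster T = {T' \<in> translates. nearest T' = nearest T}"
  by (auto simp: cluster_def close_iff_nearest)

lemma cluster_finite: "finite (cluster T)"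
  using translates_finite by (simp add: cluster_def)

lemma cluster_self: "T \<in> translates \<Longrightarrow> T \<in> cluster T"
  by (simp add: cluster_nearest)

lemma card_cluster:
  assumes "T \<in> translates"
  shows "card (cluster T) = card (cluster A1)"
proof -
  obtain g where g: "aut g" "g ` A1 = T"
    using translates_transitive[OF A1_translate assms] by blast
  show ?thesis unfolding cluster_def g(2)[symmetric]
    using g(1) A1_translate by (intro card_Collect_bij_betw[OF aut_bij_translates[OF g(1)]] close_aut)
qed

text \<open>
  A majority vote inside each cluster turns the approximately permuted translates into exact
  blocks of imprimitivity.
\<close>

definition block :: "'a set \<Rightarrow> 'a set" where
  "block T = {x \<in> V. card (cluster T) < 2 * card {T' \<in> cluster T. x \<in> T'}}"

lemma block_aut:
  assumes "aut g" "T \<in> translates" "x \<in> V"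
  shows "g x \<in> block (g ` T) \<longleftrightarrow> x \<in> block T"
proof -
  have "card {T' \<in> translates. close (g ` T) T' \<and> g x \<in> T'} = card {T' \<in> translates. close T T' \<and> x \<in> T'}"
    using assms translate_subset
    by (intro card_Collect_bij_betw[OF aut_bij_translates[OF assms(1)]])
      (simp add: close_aut aut_mem_image)
  moreover have "card (cluster (g ` T)) = card (cluster T)"
    using card_cluster assms aut_translate by simp
  ultimately show ?thesis
    using assms(3) aut_in_V[OF assms(1,3)] by (simp add: block_def cluster_def)
qed

lemma block_eq: "T \<in> translates \<Longrightarrow> T' \<in> translates \<Longrightarrow> nearest T = nearest T' \<Longrightarrow> block T = block T'"
  by (simp add: block_def cluster_nearest)

text \<open>Clusters are the non-empty fibres of \<open>nearest\<close>, and all have the same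
  size.\<close>

lemma card_translates_le: "card translates \<le> card P * card (cluster A1)"
proof -
  have "card translates = card (\<Union>A\<in>P. {T \<in> translates. nearest T = A})"
    using nearest(1) by (intro arg_cong[where f=card]) auto
  also have "\<dots> \<le> (\<Sum>A\<in>P. card {T \<in> translates. nearest T = A})"
    by (rule card_UN_le[OF P_finite])
  also have "\<dots> \<le> (\<Sum>A\<in>P. card (cluster A1))"
  proof (rule sum_mono)
    fix A assume "A \<in> P"
    show "card {T \<in> translates. nearest T = A} \<le> card (cluster A1)"
    proof (cases "\<exists>T0\<in>translates. nearest T0 = A")
      case True
      then obtain T0 where T0: "T0 \<in> translates" "nearest T0 = A" by auto
      then have "{T \<in> translates. nearest T = A} = cluster T0" by (simp add: cluster_nearest)
      then show ?thesis using card_cluster[OF T0(1)] by simp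
    next
      case False
      then have "{T \<in> translates. nearest T = A} = {}" by auto
      then show ?thesis by (simp only: card.empty le0)
    qed
  qed
  finally show ?thesis by simp
qed

text \<open>By transitivity every vertex lies in the same number d of translates. Counting
  incidences gives |V| d = |translates| |A1|, which is at most |P| |cluster A1| |A1|, and |P| |A1|
  \<le> |V| because \<open>A1\<close> is smallest.\<close>

lemma card_translates_through:
  assumes "x \<in> V"
  shows "card {T \<in> translates. x \<in> T} \<le> card (cluster A1)"
proof -
  have const: "card {T \<in> translates. y \<in> T} = card {T \<in> translates. x \<in> T}" if y: "y \<in> V" for y
  proof -
    obtain g where g: "aut g" "g x = y" by (rule aut_moves[OF assms y])
    show ?thesis unfolding g(2)[symmetric]
      by (rule card_Collect_bij_betw[OF aut_bij_translates[OF g(1)]])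
        (rule aut_mem_image[OF g(1) translate_subset assms])
  qed
  have "card V * card {T \<in> translates. x \<in> T} = (\<Sum>y\<in>V. card {T \<in> translates. x \<in> T})"
    by simp
  also have "\<dots> = (\<Sum>y\<in>V. card {T \<in> translates. y \<in> T})"
    by (rule sum.cong[OF refl const[symmetric]])
  also have "\<dots> = (\<Sum>T\<in>translates. card {y \<in> V. y \<in> T})"
    by (rule sum_card_Collect_swap[OF finite_V translates_finite])
  also have "\<dots> = (\<Sum>T\<in>translates. card A1)"
  proof (rule sum.cong[OF refl])
    fix T assume T: "T \<in> translates"
    then have "{y \<in> V. y \<in> T} = T" using translate_subset by auto
    then show "card {y \<in> V. y \<in> T} = card A1" using translate_card T by simp
  qed
  also have "\<dots> = card translates * card A1" by simp
  also have "\<dots> \<le> (card P * card (cluster A1)) * card A1"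
    using card_translates_le by (rule mult_right_mono) simp
  also have "\<dots> \<le> card V * card (cluster A1)"
    using mult_right_mono[OF card_V_ge, of "card (cluster A1)"] by (simp add: mult_ac)
  finally have "card V * card {T \<in> translates. x \<in> T} \<le> card V * card (cluster A1)" .
  moreover have "0 < card V" using assms finite_V by (auto simp: card_gt_0_iff)
  ultimately show ?thesis by (simp only: mult_le_cancel1)
qed

text \<open>Majorities in two disjoint clusters would put \<open>x\<close> into more than
  \<open>card (cluster A1)\<close> translates.\<close>

lemma block_disjoint:
  assumes "T \<in> translates" "T' \<in> translates" "x \<in> block T" "x \<in> block T'"
  shows "nearest T = nearest T'"
proof (rule ccontr)
  assume ne: "nearest T \<noteq> nearest T'"
  let ?S = "{S \<in> cluster T. x \<in> S}" and ?S' = "{S \<in> cluster T'. x \<in> S}"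
  have "?S \<inter> ?S' = {}" using ne assms by (auto simp: cluster_nearest)
  then have "card ?S + card ?S' = card (?S \<union> ?S')"
    using cluster_finite by (simp add: card_Un_disjoint)
  also have "\<dots> \<le> card {S \<in> translates. x \<in> S}"
    using translates_finite by (intro card_mono) (auto simp: cluster_def)
  also have "\<dots> \<le> card (cluster A1)"
    using assms(3) by (intro card_translates_through) (simp add: block_def)
  finally show False
    using assms card_cluster by (auto simp: block_def)
qed

text \<open>A block point lies in more than half of the cluster, and every member of the cluster has
  fewer than c|A1| points outside the common nearest part; average.\<close>

lemma card_block_diff_nearest:
  assumes "T \<in> translates"
  shows "card (block T - nearest T) \<le> 2 * (c * card A1)"
proof (rule card_le_double_average)
  show "finite (block T - nearest T)" using finite_V by (simp add: block_def)
  show "finite (cluster T)" by (rule cluster_finite)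
  show "cluster T \<noteq> {}" using cluster_self assms by auto
next
  fix x assume "x \<in> block T - nearest T"
  then show "card (cluster T) \<le> 2 * card {T' \<in> cluster T. x \<in> T'}" by (simp add: block_def)
next
  fix T' assume "T' \<in> cluster T"
  then have T': "T' \<in> translates" "nearest T' = nearest T" using assms by (auto simp: cluster_nearest)
  have "card {x \<in> block T - nearest T. x \<in> T'} \<le> card (T' - nearest T')"
    using T' translate_finite by (intro card_mono) auto
  then show "real (card {x \<in> block T - nearest T. x \<in> T'}) \<le> c * card A1"
    using card_diff_nearest[OF T'(1)] by linarith
qed

text \<open>The dual average: a point that loses the vote is missed by at least half of the cluster,
  while each member misses few points of the nearest part.\<close>

lemma card_nearest_diff_block:
  assumes "T \<in> translates"
  shows "card (nearest T - block T) \<le> 2 * (c * card (nearest T))"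
proof (rule card_le_double_average)
  show "finite (nearest T - block T)" using part_finite nearest(1) assms by simp
  show "finite (cluster T)" by (rule cluster_finite)
  show "cluster T \<noteq> {}" using cluster_self assms by auto
next
  fix x assume x: "x \<in> nearest T - block T"
  then have "x \<in> V" using part_subset nearest(1) assms by blast
  then have "2 * card {T' \<in> cluster T. x \<in> T'} \<le> card (cluster T)" using x by (auto simp: block_def)
  moreover have "card (cluster T) = card {T' \<in> cluster T. x \<in> T'} + card {T' \<in> cluster T. x \<notin> T'}"
    using cluster_finite by (subst card_Un_disjoint[symmetric]) (auto intro!: arg_cong[where f=card])
  ultimately show "card (cluster T) \<le> 2 * card {T' \<in> cluster T. x \<notin> T'}" by linarith
next
  fix T' assume "T' \<in> cluster T"
  then have T': "T' \<in> translates" "nearest T' = nearest T" using assms by (auto simp: cluster_nearest)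
  have "card {x \<in> nearest T - block T. x \<notin> T'} \<le> card (nearest T' - T')"
    using T' part_finite nearest(1)[OF T'(1)] by (intro card_mono) auto
  then show "real (card {x \<in> nearest T - block T. x \<notin> T'}) \<le> c * card (nearest T)"
    using nearest(2)[OF T'(1)] T'(2) by simp
qed

lemma card_nearest_Int_block:
  assumes "T \<in> translates"
  shows "(1 - 2 * c) * card (nearest T) \<le> card (nearest T \<inter> block T)"
proof -
  have "card (nearest T) = card (nearest T - block T) + card (nearest T \<inter> block T)"
    using part_finite[OF nearest(1)[OF assms]]
    by (subst card_Un_disjoint[symmetric]) (auto intro!: arg_cong[where f=card])
  then show ?thesis using card_nearest_diff_block[OF assms] by (simp add: algebra_simps)
qed

lemma block_nonempty:
  assumes "T \<in> translates"
  shows "block T \<noteq> {}"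
proof -
  have "0 < (1 - 2 * c) * card (nearest T)"
    using c_le A1_card_pos smallest[OF nearest(1)[OF assms]] by (intro mult_pos_pos) auto
  then have "0 < card (nearest T \<inter> block T)" using card_nearest_Int_block[OF assms] by linarith
  then show ?thesis by auto
qed

lemma blocks_cover:
  assumes "x \<in> V"
  shows "\<exists>T\<in>translates. x \<in> block T"
proof -
  obtain y where y: "y \<in> block A1" using block_nonempty[OF A1_translate] by auto
  then have "y \<in> V" by (simp add: block_def)
  then obtain g where "aut g" "g y = x" using aut_moves assms by metis
  then show ?thesis using y block_aut A1_translate aut_translate \<open>y \<in> V\<close> by metis
qed

text \<open>Otherwise a second part would lie entirely in the small set
  \<open>block A1 - nearest A1\<close>, although no part is smaller than \<open>A1\<close>.\<close>

lemma block_A1_proper: "block A1 \<noteq> V"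
proof
  assume full: "block A1 = V"
  have "\<not> P \<subseteq> {nearest A1}"
    using two_parts card_mono[of "{nearest A1}" P] by auto
  then obtain A where A: "A \<in> P" "A \<noteq> nearest A1" by auto
  then have "A \<subseteq> block A1 - nearest A1"
    using full part_subset part_disjoint nearest(1)[OF A1_translate] by blast
  then have "card A \<le> card (block A1 - nearest A1)"
    using finite_V full by (intro card_mono) auto
  then have "real (card A1) \<le> 2 * (c * card A1)"
    using smallest[OF A(1)] card_block_diff_nearest[OF A1_translate] by linarith
  also have "\<dots> < card A1" using c_le A1_card_pos by simp
  finally show False by simp
qed

section \<open>Edges between blocks force a large boundary\<close>

text \<open>Edges between different blocks are invariant under automorphisms, which edges between
  different parts of \<open>P\<close> need not be.\<close>

definition crossing :: "'a \<Rightarrow> 'a \<Rightarrow> bool" where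
  "crossing x y \<longleftrightarrow> {x, y} \<in> E \<and> \<not> (\<exists>T\<in>translates. x \<in> block T \<and> y \<in> block T)"

lemma crossing_sym: "crossing x y \<Longrightarrow> crossing y x"
  by (auto simp: crossing_def insert_commute)

lemma crossing_aut:
  assumes "aut g" "x \<in> V" "y \<in> V"
  shows "crossing (g x) (g y) \<longleftrightarrow> crossing x y"
proof -
  have image: "(`) g ` translates = translates"
    using aut_bij_translates[OF assms(1)] by (simp add: bij_betw_def)
  have "(\<exists>T\<in>(`) g ` translates. g x \<in> block T \<and> g y \<in> block T) \<longleftrightarrow>
      (\<exists>T\<in>translates. x \<in> block T \<and> y \<in> block T)"
    using assms by (simp add: block_aut cong: bex_cong)
  then show ?thesis using assms by (simp add: crossing_def aut_edge image)
qed

text \<open>The degree is constant by transitivity. It is positive because connectedness provides an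
  edge leaving the non-empty proper set \<open>block A1\<close>.\<close>

lemma crossing_regular: "\<exists>k>0. \<forall>x\<in>V. card {y \<in> V. crossing x y} = k"
proof -
  obtain u v where uv: "u \<in> block A1" "v \<in> V - block A1" "{u, v} \<in> E"
    using edge_leaving[of "block A1"] block_nonempty[OF A1_translate] block_A1_proper
    by (auto simp: block_def)
  \<comment> \<open>A block containing \<open>u\<close> is \<open>block A1\<close> itself, so no
    block contains both ends of the edge.\<close>
  have "v \<in> block A1" if T: "T \<in> translates" "u \<in> block T" "v \<in> block T" for T
    using block_eq[OF T(1) A1_translate block_disjoint[OF T(1) A1_translate T(2) uv(1)]] T(3) by simp
  then have "crossing u v" using uv(2,3) by (auto simp: crossing_def)
  then have pos: "0 < card {y \<in> V. crossing u y}" using uv finite_V by (auto simp: card_gt_0_iff)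
  have "card {y \<in> V. crossing x y} = card {y \<in> V. crossing u y}" if x: "x \<in> V" for x
  proof -
    have u: "u \<in> V" using uv by (simp add: block_def)
    obtain g where g: "aut g" "g u = x" by (rule aut_moves[OF u x])
    show ?thesis unfolding g(2)[symmetric]
      using u g(1) by (intro card_Collect_bij_betw[OF aut_bij[OF g(1)]] crossing_aut)
  qed
  then show ?thesis using pos by blast
qed

text \<open>The vertices on which the block system agrees with the partition.\<close>

definition good :: "'a set" where
  "good = (\<Union>T\<in>translates. nearest T \<inter> block T)"

lemma card_bad: "card (V - good) \<le> 2 * c * card P * card A1"
proof -
  let ?D = "\<lambda>A. \<Union>T\<in>{T \<in> translates. nearest T = A}. block T - A"
  have "V - good \<subseteq> (\<Union>A\<in>P. ?D A)"
  proof
    fix x assume x: "x \<in> V - good"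
    then obtain T where T: "T \<in> translates" "x \<in> block T" using blocks_cover by blast
    moreover have "x \<notin> nearest T" using x T unfolding good_def by blast
    ultimately have "x \<in> ?D (nearest T)" by blast
    then show "x \<in> (\<Union>A\<in>P. ?D A)" using nearest(1)[OF T(1)] by blast
  qed
  moreover have "finite (\<Union>A\<in>P. ?D A)"
    using finite_V by (rule finite_subset[rotated]) (auto simp: block_def)
  ultimately have "card (V - good) \<le> card (\<Union>A\<in>P. ?D A)" by (rule card_mono[rotated])
  also have "\<dots> \<le> (\<Sum>A\<in>P. card (?D A))" by (rule card_UN_le[OF P_finite])
  finally have "real (card (V - good)) \<le> (\<Sum>A\<in>P. real (card (?D A)))"
    unfolding of_nat_sum[symmetric] by (rule of_nat_mono)
  also have "\<dots> \<le> (\<Sum>A\<in>P. 2 * (c * card A1))"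
  proof (rule sum_mono)
    fix A assume "A \<in> P"
    show "real (card (?D A)) \<le> 2 * (c * card A1)"
    proof (cases "\<exists>T\<in>translates. nearest T = A")
      case True
      then obtain T where T: "T \<in> translates" "nearest T = A" by auto
      \<comment> \<open>All translates with nearest part \<open>A\<close> define one block, so the
        union over them is a single difference.\<close>
      have "block T' = block T" if "T' \<in> translates" "nearest T' = A" for T'
        using block_eq[OF that(1) T(1)] that(2) T(2) by simp
      then have "?D A = block T - nearest T" using T by blast
      then show ?thesis using card_block_diff_nearest[OF T(1)] by (simp only:)
    next
      case False
      then have "?D A = {}" by blast
      then have "card (?D A) = 0" by (simp only: card.empty)
      then show ?thesis using c_pos by simp
    qed
  qed
  also have "\<dots> = 2 * c * card P * card A1" by simp
  finally show ?thesis .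
qed

text \<open>For good vertices, lying in the same part means lying in the same block, which a
  crossing edge excludes.\<close>

lemma crossing_leaves_nearest:
  assumes "T \<in> translates" "x \<in> nearest T \<inter> block T" "y \<in> good" "crossing x y"
  shows "y \<in> V - nearest T"
proof -
  obtain T' where T': "T' \<in> translates" "y \<in> nearest T'" "y \<in> block T'"
    using assms(3) by (auto simp: good_def)
  have "nearest T' \<noteq> nearest T"
    using assms(1,2,4) T'(1,3) block_eq[OF T'(1) assms(1)] by (auto simp: crossing_def)
  then have "nearest T' \<inter> nearest T = {}" using part_disjoint nearest(1) T'(1) assms(1) by simp
  then show ?thesis using T'(2,3) by (auto simp: block_def)
qed

text \<open>The part nearest to \<open>A1\<close> serves as witness: crossing edges from its core
  \<open>C\<close> leave it except where they meet the few vertices outside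
  \<open>good\<close>.\<close>

lemma large_boundary:
  "\<exists>A\<in>P. (1 - 2 * c - 2 * c * card P) * card A \<le> card (inner_boundary V E A)
       \<and> (1 - 2 * c - 2 * c * card P) * card A \<le> card (outer_boundary V E A)"
proof -
  define A where "A = nearest A1"
  define C where "C = A \<inter> block A1"
  have A: "A \<in> P" using nearest(1)[OF A1_translate] by (simp add: A_def)
  have CV: "C \<subseteq> V" "finite C" using part_subset[OF A] part_finite[OF A] by (auto simp: C_def)
  obtain k where k: "k > 0" "\<And>x. x \<in> V \<Longrightarrow> card {y \<in> V. crossing x y} = k"
    using crossing_regular by blast
  have leave: "y \<in> V - A" if "x \<in> C" "y \<in> good" "crossing x y" for x y
    using crossing_leaves_nearest[OF A1_translate] that by (simp add: A_def C_def)
  note neighbours = card_le_card_regular_neighbours[OF finite_V _ k(1) crossing_sym k(2)]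
  have fin: "finite (inner_boundary V E A)" "finite (outer_boundary V E A)"
    using part_finite[OF A] finite_V by (auto simp: inner_boundary_def outer_boundary_def)
  have inner: "card C \<le> card (inner_boundary V E A) + card (V - good)"
  proof -
    \<comment> \<open>The core vertices that may fail to be on the inner boundary. All their
      crossing neighbours are bad, so regularity bounds their number by that of the bad
      vertices.\<close>
    define S where "S = {x \<in> C. \<forall>y\<in>V. crossing x y \<longrightarrow> y \<notin> good}"
    have "S \<subseteq> V" using CV(1) by (auto simp: S_def)
    then have "card S \<le> card {y \<in> V. \<exists>x\<in>S. crossing x y}" by (rule neighbours)
    also have "\<dots> \<le> card (V - good)" using finite_V by (intro card_mono) (auto simp: S_def)
    finally have S: "card S \<le> card (V - good)" .
    have "C \<subseteq> inner_boundary V E A \<union> S"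
    proof
      fix x assume x: "x \<in> C"
      show "x \<in> inner_boundary V E A \<union> S"
      proof (cases "x \<in> S")
        case False
        then obtain y where y: "y \<in> good" "crossing x y" using x by (auto simp: S_def)
        then have "y \<in> V - A" "{x, y} \<in> E" using leave[OF x] by (auto simp: crossing_def)
        then show ?thesis using x unfolding inner_boundary_def C_def by blast
      qed simp
    qed
    then have "card C \<le> card (inner_boundary V E A \<union> S)"
      using fin CV(2) by (intro card_mono) (auto simp: S_def)
    also have "\<dots> \<le> card (inner_boundary V E A) + card S" by (rule card_Un_le)
    finally show ?thesis using S by linarith
  qed
  have outer: "card C \<le> card (outer_boundary V E A) + card (V - good)"
  proof -
    \<comment> \<open>By regularity the core has at least |C| crossing neighbours, and the good ones
      all lie on the outer boundary.\<close>
    have "card C \<le> card {y \<in> V. \<exists>x\<in>C. crossing x y}" by (rule neighbours[OF CV(1)])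
    also have "\<dots> \<le> card (outer_boundary V E A \<union> (V - good))"
    proof (rule card_mono)
      show "finite (outer_boundary V E A \<union> (V - good))" using fin finite_V by simp
      show "{y \<in> V. \<exists>x\<in>C. crossing x y} \<subseteq> outer_boundary V E A \<union> (V - good)"
      proof
        fix y assume "y \<in> {y \<in> V. \<exists>x\<in>C. crossing x y}"
        then obtain x where x: "x \<in> C" "crossing x y" and y: "y \<in> V" by auto
        have "y \<in> outer_boundary V E A" if "y \<in> good"
        proof -
          have "y \<in> V - A" "{x, y} \<in> E" using leave[OF x(1) that x(2)] x(2) by (auto simp: crossing_def)
          then show ?thesis using x(1) unfolding outer_boundary_def C_def by blast
        qed
        then show "y \<in> outer_boundary V E A \<union> (V - good)" using y by blast
      qed
    qed
    also have "\<dots> \<le> card (outer_boundary V E A) + card (V - good)" by (rule card_Un_le)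
    finally show ?thesis .
  qed
  have "2 * c * card P * card A1 \<le> 2 * c * card P * card A"
    using smallest[OF A] c_pos by (intro mult_left_mono) auto
  then have "(1 - 2 * c - 2 * c * card P) * card A \<le> real (card C) - card (V - good)"
    using card_bad card_nearest_Int_block[OF A1_translate]
    by (simp add: A_def[symmetric] C_def[symmetric] algebra_simps)
  then show ?thesis using inner outer A by (intro bexI[of _ A]) linarith+
qed

end

section \<open>Optimal partitions for an arbitrary boundary size\<close>

text \<open>The common form of both constants, with \<open>b\<close> the size of the boundary, so
  that the step from n to n + 1 is proved once.\<close>

definition isoperimetric :: "('a set \<Rightarrow> nat) \<Rightarrow> 'a set \<Rightarrow> nat \<Rightarrow> real" where
  "isoperimetric b V n = Min ((\<lambda>P. Max ((\<lambda>A. real (b A) / real (card A)) ` P)) ` n_partitions V n)"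

text \<open>Enumerate \<open>V\<close> and take residue classes modulo \<open>n\<close>: class
  \<open>r\<close> contains \<open>r + n * q\<close> for every \<open>q < card V div n\<close>. This
  shows that the minimum ranges over a non-empty set, and later bounds the vertex constant.\<close>

lemma balanced_partition_exists:
  assumes "finite V" "0 < n" "n \<le> card V"
  shows "\<exists>P\<in>n_partitions V n. \<forall>A\<in>P. card V div n \<le> card A"
proof -
  obtain f where f: "bij_betw f {0..<card V} V"
    using ex_bij_betw_nat_finite[OF assms(1)] by blast
  define R where "R r = {i \<in> {0..<card V}. i mod n = r}" for r
  have inj: "inj_on f {0..<card V}" and img: "f ` {0..<card V} = V"
    using f by (auto simp: bij_betw_def)
  have R_sub: "R r \<subseteq> {0..<card V}" for r by (auto simp: R_def)
  have card_R: "card V div n \<le> card (f ` R r)" if "r < n" for r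
  proof -
    have sub: "(\<lambda>q. r + n * q) ` {0..<card V div n} \<subseteq> R r"
    proof
      fix i assume "i \<in> (\<lambda>q. r + n * q) ` {0..<card V div n}"
      then obtain q where q: "q < card V div n" "i = r + n * q" by auto
      have "i < n * Suc q" using q that by simp
      also have "\<dots> \<le> n * (card V div n)" using q by (intro mult_le_mono2) simp
      also have "\<dots> \<le> card V" by (rule times_div_less_eq_dividend)
      finally show "i \<in> R r" using q that by (simp add: R_def)
    qed
    have "inj_on (\<lambda>q. r + n * q) {0..<card V div n}" using assms(2) by (simp add: inj_on_def)
    then have "card {0..<card V div n} \<le> card (R r)"
      by (rule card_inj_on_le[OF _ sub]) (simp add: R_def)
    then show ?thesis using inj_on_subset[OF inj R_sub] by (simp add: card_image)
  qed
  have pos: "0 < card V div n" using assms by (simp add: div_greater_zero_iff)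
  have nonempty: "f ` R r \<noteq> {}" if "r < n" for r
  proof
    assume "f ` R r = {}"
    then show False using card_R[OF that] pos by (simp only: card.empty)
  qed
  have disj: "f ` R r \<inter> f ` R s = {}" if "r \<noteq> s" for r s
  proof -
    have "f ` R r \<inter> f ` R s = f ` (R r \<inter> R s)"
      using inj_on_image_Int[OF inj R_sub R_sub] by simp
    also have "R r \<inter> R s = {}" using that by (auto simp: R_def)
    finally show ?thesis by simp
  qed
  let ?P = "(\<lambda>r. f ` R r) ` {0..<n}"
  have "(\<Union>r\<in>{0..<n}. R r) = {0..<card V}" using assms(2) by (auto simp: R_def)
  then have union: "\<Union>?P = V" using img by (simp only: image_UN[symmetric])
  have "partition_on V ?P"
  proof (rule partition_onI[OF union])
    fix p q assume "p \<in> ?P" "q \<in> ?P" "p \<noteq> q"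
    then obtain r s where "p = f ` R r" "q = f ` R s" "r \<noteq> s" by blast
    then show "disjnt p q" using disj[of r s] by (simp add: disjnt_def)
  next
    show "{} \<notin> ?P"
    proof
      assume "{} \<in> ?P"
      then obtain r where "{} = f ` R r" "r \<in> {0..<n}" by (rule imageE)
      then show False using nonempty[of r] by simp
    qed
  qed
  moreover have "inj_on (\<lambda>r. f ` R r) {0..<n}"
  proof (rule inj_onI)
    fix r s assume r: "r \<in> {0..<n}" and eq: "f ` R r = f ` R s"
    show "r = s"
    proof (rule ccontr)
      assume "r \<noteq> s"
      from disj[OF this] have "f ` R r = {}" unfolding eq by (simp only: Int_absorb)
      then show False using nonempty r by simp
    qed
  qed
  then have "card ?P = n" by (simp add: card_image)
  ultimately have "?P \<in> n_partitions V n" unfolding n_partitions_def by blast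
  moreover have "\<forall>A\<in>?P. card V div n \<le> card A" using card_R by simp
  ultimately show ?thesis by (rule bexI[rotated])
qed

lemma n_partitions_finite: "finite V \<Longrightarrow> finite (n_partitions V n)"
  by (rule finite_subset[of _ "Pow (Pow V)"]) (auto simp: n_partitions_def partition_on_def)

lemma n_partition_finite: "finite V \<Longrightarrow> P \<in> n_partitions V n \<Longrightarrow> finite P"
  using finite_elements by (auto simp: n_partitions_def)

lemma isoperimetric_attained:
  assumes "finite V" "0 < n" "n \<le> card V"
  obtains P where "P \<in> n_partitions V n" "\<And>A. A \<in> P \<Longrightarrow> b A / card A \<le> isoperimetric b V n"
proof -
  have "n_partitions V n \<noteq> {}" using balanced_partition_exists[OF assms] by auto
  then have "isoperimetric b V n \<in> (\<lambda>P. Max ((\<lambda>A. real (b A) / real (card A)) ` P)) ` n_partitions V n"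
    unfolding isoperimetric_def using n_partitions_finite[OF assms(1)] by (intro Min_in) auto
  then obtain P where P: "P \<in> n_partitions V n"
      "isoperimetric b V n = Max ((\<lambda>A. real (b A) / real (card A)) ` P)" by blast
  have "b A / card A \<le> isoperimetric b V n" if "A \<in> P" for A
    unfolding P(2) using that n_partition_finite[OF assms(1) P(1)] by (intro Max_ge) auto
  then show thesis using P(1) that by blast
qed

lemma isoperimetric_le:
  assumes "finite V" "0 < n" "P \<in> n_partitions V n" "\<And>A. A \<in> P \<Longrightarrow> b A / card A \<le> t"
  shows "isoperimetric b V n \<le> t"
proof -
  have P: "finite P" "P \<noteq> {}" using n_partition_finite assms by (auto simp: n_partitions_def)
  have "isoperimetric b V n \<le> Max ((\<lambda>A. real (b A) / real (card A)) ` P)"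
    unfolding isoperimetric_def using n_partitions_finite assms(1,3) by (intro Min_le) auto
  also have "\<dots> \<le> t" using P assms(4) by simp
  finally show ?thesis .
qed

lemma isoperimetric_nonneg:
  assumes "finite V" "0 < n" "n \<le> card V"
  shows "0 \<le> isoperimetric b V n"
proof -
  obtain P where P: "P \<in> n_partitions V n" "\<And>A. A \<in> P \<Longrightarrow> b A / card A \<le> isoperimetric b V n"
    by (rule isoperimetric_attained[OF assms, of b]) (rule that)
  have "P \<noteq> {}" using P(1) assms(2) by (auto simp: n_partitions_def)
  then obtain A where A: "A \<in> P" by blast
  have "0 \<le> real (b A) / real (card A)" by simp
  also have "\<dots> \<le> isoperimetric b V n" by (rule P(2)[OF A])
  finally show ?thesis .
qed

lemma split_off_partition:
  assumes "finite P" "partition_on V P" "T \<subseteq> V" "T \<noteq> {}" "\<And>A. A \<in> P \<Longrightarrow> A - T \<noteq> {}"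
  shows "insert T ((\<lambda>A. A - T) ` P) \<in> n_partitions V (card P + 1)"
proof -
  have disj: "A \<inter> A' = {}" if "A \<in> P" "A' \<in> P" "A \<noteq> A'" for A A'
    using that assms(2) by (auto simp: partition_on_def disjoint_def)
  have union: "\<Union>P = V" using assms(2) by (simp add: partition_on_def)
  have "partition_on V (insert T ((\<lambda>A. A - T) ` P))"
  proof (rule partition_onI)
    show "\<Union> (insert T ((\<lambda>A. A - T) ` P)) = V" using union assms(3) by auto
    show "{} \<notin> insert T ((\<lambda>A. A - T) ` P)" using assms(4,5) by blast
    fix p q assume "p \<in> insert T ((\<lambda>A. A - T) ` P)" "q \<in> insert T ((\<lambda>A. A - T) ` P)" "p \<noteq> q"
    then show "disjnt p q" using disj unfolding disjnt_def by blast
  qed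
  \<comment> \<open>Distinct parts leave disjoint non-empty remainders, so no two of them
    merge.\<close>
  moreover have "inj_on (\<lambda>A. A - T) P"
  proof (rule inj_onI)
    fix A A' assume A: "A \<in> P" "A' \<in> P" "A - T = A' - T"
    then show "A = A'" using assms(5)[OF A(1)] disj[OF A(1,2)] by blast
  qed
  then have "card ((\<lambda>A. A - T) ` P) = card P" by (rule card_image)
  moreover have "T \<notin> (\<lambda>A. A - T) ` P" using assms(4) by auto
  ultimately show ?thesis using assms(1) by (simp add: n_partitions_def)
qed

section \<open>The step from n to n + 1 parts\<close>

context transitive_graph
begin

text \<open>
  \<open>b\<close> is \<open>|\<partial>A|\<close> with \<open>l = 1\<close> or \<open>|\<delta>A|\<close> with \<open>l = 2\<close>: the factor counts how many of the
  inner and the outer boundary contribute to \<open>b\<close>.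
\<close>

lemma isoperimetric_step:
  fixes b :: "'a set \<Rightarrow> nat" and l :: real
  assumes n: "2 \<le> n" "n + 1 \<le> card V" and l: "0 < l"
    and b_aut: "\<And>g A. aut g \<Longrightarrow> A \<subseteq> V \<Longrightarrow> b (g ` A) = b A"
    and b_diff: "\<And>A B. A \<subseteq> V \<Longrightarrow> B \<subseteq> V \<Longrightarrow> b (A - B) \<le> b A + b B"
    and b_large: "\<And>A (t::real). A \<subseteq> V \<Longrightarrow> t \<le> card (inner_boundary V E A) \<Longrightarrow>
      t \<le> card (outer_boundary V E A) \<Longrightarrow> l * t \<le> b A"
  shows "l * isoperimetric b V (n + 1) / (10 * l * n + isoperimetric b V (n + 1)) \<le> isoperimetric b V n"
proof -
  define h where "h = isoperimetric b V n"
  define h' where "h' = isoperimetric b V (n + 1)"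
  have h: "0 \<le> h" "0 \<le> h'"
    unfolding h_def h'_def using n finite_V by (auto intro!: isoperimetric_nonneg)
  have "l * h' \<le> h * (10 * l * n + h')"
  \<comment> \<open>For \<open>l \<le> h\<close> the claim is trivial, since the fraction on its
    left never exceeds \<open>l\<close>.\<close>
  proof (cases "l \<le> h")
    case True
    then have "l * h' \<le> h * h'" using h by (intro mult_right_mono)
    moreover have "0 \<le> h * (10 * l * n)" using h l by simp
    ultimately show ?thesis by (simp only: distrib_left)
  next
    case False
    \<comment> \<open>Chosen so that 2h / c = 10nh / (1 - h / l), which gives the constant 10n,
      while \<open>c\<close> is still small enough to refute rigidity.\<close>
    define c where "c = (1 - h / l) / (5 * n)"
    have cn: "5 * c * n = 1 - h / l" using n by (simp add: c_def)
    have c_pos: "0 < c" using False l n by (simp add: c_def)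
    obtain P where P: "P \<in> n_partitions V n" "\<And>A. A \<in> P \<Longrightarrow> b A / card A \<le> h"
      unfolding h_def using isoperimetric_attained[of V n b] finite_V n by auto
    have P_part: "partition_on V P" "card P = n" using P(1) by (auto simp: n_partitions_def)
    have finP: "finite P" by (rule n_partition_finite[OF finite_V P(1)])
    have sub: "A \<subseteq> V" if "A \<in> P" for A using that P_part(1) by (auto simp: partition_on_def)
    have pos: "0 < card A" if "A \<in> P" for A
      using that P_part(1) sub[OF that] finite_subset[OF _ finite_V]
      by (auto simp: partition_on_def card_gt_0_iff)
    have b_le: "b A \<le> h * card A" if "A \<in> P" for A
      using P(2)[OF that] pos[OF that] by (simp add: pos_divide_le_eq)
    have "P \<noteq> {}" using P_part(2) n by auto
    then obtain A1 where A1: "A1 \<in> P" "\<And>A. A \<in> P \<Longrightarrow> card A1 \<le> card A"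
      using arg_min_if_finite[OF finP, of card] by (metis not_less)
    have "\<not> (\<forall>g. aut g \<longrightarrow> (\<exists>A\<in>P. card (A - g ` A1) < c * card A))"
    proof
      assume rigid: "\<forall>g. aut g \<longrightarrow> (\<exists>A\<in>P. card (A - g ` A1) < c * card A)"
      interpret rigid_partition V E P A1 c
        using P_part A1 n c_pos cn h l rigid by unfold_locales auto
      obtain A where A: "A \<in> P"
          "(1 - 2 * c - 2 * c * card P) * card A \<le> card (inner_boundary V E A)"
          "(1 - 2 * c - 2 * c * card P) * card A \<le> card (outer_boundary V E A)"
        using large_boundary by blast
      have "l * ((1 - 2 * c - 2 * c * card P) * card A) \<le> b A"
        by (rule b_large[OF sub[OF A(1)] A(2,3)])
      also have "\<dots> \<le> h * card A" by (rule b_le[OF A(1)])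
      finally have "(l * (1 - 2 * c - 2 * c * n)) * card A \<le> h * card A"
        using P_part(2) by (simp only: mult.assoc)
      then have "l * (1 - 2 * c - 2 * c * n) \<le> h" using pos[OF A(1)] by simp
      then have "1 - 2 * c - 2 * c * n \<le> h / l" using l by (simp add: pos_le_divide_eq mult.commute)
      \<comment> \<open>Substituting 1 - h / l = 5cn leaves 5cn \<le> 2c + 2cn, hence 3n \<le> 2,
        which is impossible.\<close>
      then have "c * (3 * n) \<le> c * 2" using cn by (simp add: algebra_simps)
      then show False using c_pos n by simp
    qed
    then obtain g where g: "aut g" "\<And>A. A \<in> P \<Longrightarrow> c * card A \<le> card (A - g ` A1)"
      by (auto simp: not_less)
    let ?T = "g ` A1"
    have T: "?T \<subseteq> V" using aut_in_V[OF g(1)] sub[OF A1(1)] by auto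
    have c_card: "0 < c * card A" if "A \<in> P" for A using c_pos pos[OF that] by simp
    have "insert ?T ((\<lambda>A. A - ?T) ` P) \<in> n_partitions V (card P + 1)"
    proof (rule split_off_partition[OF finP P_part(1) T])
      show "?T \<noteq> {}" using pos[OF A1(1)] by auto
      show "A - ?T \<noteq> {}" if "A \<in> P" for A
      proof
        assume "A - ?T = {}"
        then have "card (A - ?T) = 0" by (simp only: card.empty)
        then show False using g(2)[OF that] c_card[OF that] by linarith
      qed
    qed
    moreover have "b B / card B \<le> 2 * h / c" if B: "B \<in> insert ?T ((\<lambda>A. A - ?T) ` P)" for B
    proof (cases "B = ?T")
      case True
      \<comment> \<open>The translate keeps the ratio of \<open>A1\<close>, at most
        \<open>h\<close>; since c \<le> 1, this is below 2h / c.\<close>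
      have "c \<le> 5 * c * n" using n c_pos by simp
      also have "\<dots> \<le> 1" using cn h l by simp
      finally have "h * c \<le> h * 2" using h by (intro mult_left_mono) auto
      then have "h \<le> 2 * h / c" using c_pos by (simp add: pos_le_divide_eq mult.commute)
      then show ?thesis
        using P(2)[OF A1(1)] True b_aut[OF g(1) sub[OF A1(1)]] aut_card_image[OF g(1) sub[OF A1(1)]] by simp
    next
      case False
      then obtain A where A: "A \<in> P" "B = A - ?T" using B by auto
      \<comment> \<open>Cutting out the translate at most doubles the bound h|A| on the boundary,
        and at least c|A| vertices remain.\<close>
      have "h * card A1 \<le> h * card A" using A1(2)[OF A(1)] h by (intro mult_left_mono) auto
      moreover have "b B \<le> b A + b A1"
        using b_diff[OF sub[OF A(1)] T] b_aut[OF g(1) sub[OF A1(1)]] A(2) by simp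
      ultimately have "b B \<le> 2 * h * card A" using b_le[OF A(1)] b_le[OF A1(1)] by linarith
      also have "\<dots> = 2 * h / c * (c * card A)" using c_pos by simp
      also have "\<dots> \<le> 2 * h / c * card B"
        using g(2)[OF A(1)] A(2) h c_pos by (intro mult_left_mono) auto
      finally have "b B \<le> 2 * h / c * card B" .
      moreover have "0 < real (card B)" unfolding A(2) using g(2)[OF A(1)] c_card[OF A(1)] by linarith
      ultimately show ?thesis by (simp only: pos_divide_le_eq)
    qed
    ultimately have "h' \<le> 2 * h / c"
      unfolding h'_def P_part(2) by (intro isoperimetric_le[OF finite_V]) auto
    then have "h' * c \<le> 2 * h" using c_pos by (simp only: pos_le_divide_eq)
    \<comment> \<open>Replacing 5cn by 1 - h / l gives h'(l - h) \<le> 10nhl, a rearrangement of the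
      claim.\<close>
    then have "h' * (5 * c * n) \<le> 10 * n * h" using mult_right_mono[of "h' * c" "2 * h" "5 * n"] by simp
    then have "h' * (1 - h / l) * l \<le> 10 * n * h * l" unfolding cn using l by (intro mult_right_mono) auto
    then show ?thesis using l by (simp add: algebra_simps)
  qed
  moreover have "0 < 10 * l * n + h'" using h l n by (intro add_pos_nonneg) auto
  ultimately show ?thesis unfolding h_def[symmetric] h'_def[symmetric] by (simp only: pos_divide_le_eq)
qed

section \<open>Edge and symmetric vertex boundaries fit the abstract step\<close>

lemma finite_inner_outer_boundary:
  assumes "A \<subseteq> V"
  shows "finite (inner_boundary V E A)" "finite (outer_boundary V E A)"
  using finite_subset[OF assms finite_V] finite_V by (auto simp: inner_boundary_def outer_boundary_def)

lemma finite_E: "finite E"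
  using simple by (intro finite_subset[of E "Pow V"]) (auto simp: simple_graph_def)

lemma finite_edge_boundary: "finite (edge_boundary V E A)"
  using finite_E by (simp add: edge_boundary_def edge_boundary_between_def)

text \<open>A union over pairs of endpoints, so that images under automorphisms can be computed term
  by term.\<close>

lemma edge_boundary_eq: "edge_boundary V E A = (\<Union>u\<in>A. \<Union>v\<in>V - A. {{u, v}} \<inter> E)"
  by (auto simp: edge_boundary_def edge_boundary_between_def)

lemma card_edge_boundary_aut:
  assumes "aut g" "A \<subseteq> V"
  shows "card (edge_boundary V E (g ` A)) = card (edge_boundary V E A)"
proof -
  have edge: "{{g u, g v}} \<inter> E = (`) g ` ({{u, v}} \<inter> E)" if "u \<in> A" "v \<in> V - A" for u v
    using that assms aut_edge[OF assms(1), of u v] by auto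
  have "edge_boundary V E (g ` A) = (\<Union>u\<in>A. \<Union>v\<in>V - A. {{g u, g v}} \<inter> E)"
    unfolding edge_boundary_eq aut_image_Compl[OF assms] by simp
  also have "\<dots> = (`) g ` edge_boundary V E A"
    unfolding edge_boundary_eq image_UN using edge by (intro SUP_cong refl)
  finally have "edge_boundary V E (g ` A) = (`) g ` edge_boundary V E A" .
  moreover have "inj_on ((`) g) (edge_boundary V E A)"
  proof (rule inj_on_subset)
    show "inj_on ((`) g) (Pow V)" by (rule inj_on_image_Pow) (rule aut_inj_on[OF assms(1) order_refl])
    show "edge_boundary V E A \<subseteq> Pow V"
      using simple by (auto simp: edge_boundary_def edge_boundary_between_def simple_graph_def)
  qed
  ultimately show ?thesis by (simp add: card_image)
qed

lemma card_edge_boundary_diff: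
  assumes "A \<subseteq> V" "B \<subseteq> V"
  shows "card (edge_boundary V E (A - B)) \<le> card (edge_boundary V E A) + card (edge_boundary V E B)"
proof -
  have "edge_boundary V E (A - B) \<subseteq> edge_boundary V E A \<union> edge_boundary V E B"
  proof
    fix e assume "e \<in> edge_boundary V E (A - B)"
    then obtain u v where uv: "u \<in> A - B" "v \<in> V - (A - B)" "e = {u, v}" "{u, v} \<in> E"
      by (auto simp: edge_boundary_eq)
    show "e \<in> edge_boundary V E A \<union> edge_boundary V E B"
    \<comment> \<open>If the outer end \<open>v\<close> still lies in \<open>A\<close>, it was
      removed with \<open>B\<close>, and the edge crosses the boundary of \<open>B\<close> in the
      opposite direction.\<close>
    proof (cases "v \<in> A")
      case True
      then have "e = {v, u}" "{v, u} \<in> E" "v \<in> B" "u \<in> V - B" using uv assms by (auto simp: insert_commute)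
      then show ?thesis unfolding edge_boundary_eq by blast
    next
      case False
      then show ?thesis using uv unfolding edge_boundary_eq by blast
    qed
  qed
  then have "card (edge_boundary V E (A - B)) \<le> card (edge_boundary V E A \<union> edge_boundary V E B)"
    using finite_edge_boundary by (intro card_mono) auto
  also have "\<dots> \<le> card (edge_boundary V E A) + card (edge_boundary V E B)" by (rule card_Un_le)
  finally show ?thesis .
qed

text \<open>Sending a boundary edge to its unique endpoint in \<open>A\<close> covers the inner
  boundary.\<close>

lemma card_inner_boundary_le: "card (inner_boundary V E A) \<le> card (edge_boundary V E A)"
proof (rule surj_card_le[OF finite_edge_boundary])
  show "inner_boundary V E A \<subseteq> (\<lambda>e. the_elem (e \<inter> A)) ` edge_boundary V E A"
  proof
    fix u assume "u \<in> inner_boundary V E A"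
    then obtain v where uv: "u \<in> A" "v \<in> V - A" "{u, v} \<in> E" by (auto simp: inner_boundary_def)
    then have "{u, v} \<in> edge_boundary V E A" by (auto simp: edge_boundary_eq)
    moreover have "{u, v} \<inter> A = {u}" using uv by auto
    then have "u = the_elem ({u, v} \<inter> A)" by simp
    ultimately show "u \<in> (\<lambda>e. the_elem (e \<inter> A)) ` edge_boundary V E A" by (rule rev_image_eqI)
  qed
qed

lemma sym_vertex_boundary_eq: "sym_vertex_boundary V E A = inner_boundary V E A \<union> outer_boundary V E A"
  unfolding sym_vertex_boundary_def sym_vertex_boundary_between_def edge_boundary_between_def
    inner_boundary_def outer_boundary_def
  by blast

lemma card_sym_vertex_boundary:
  assumes "A \<subseteq> V"
  shows "card (sym_vertex_boundary V E A) = card (inner_boundary V E A) + card (outer_boundary V E A)"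
  unfolding sym_vertex_boundary_eq using finite_inner_outer_boundary[OF assms]
  by (intro card_Un_disjoint) (auto simp: inner_boundary_def outer_boundary_def)

lemma card_sym_vertex_boundary_aut:
  assumes "aut g" "A \<subseteq> V"
  shows "card (sym_vertex_boundary V E (g ` A)) = card (sym_vertex_boundary V E A)"
proof -
  have "sym_vertex_boundary V E (g ` A) = g ` sym_vertex_boundary V E A"
    by (simp only: sym_vertex_boundary_eq inner_boundary_aut[OF assms] outer_boundary_aut[OF assms] image_Un)
  moreover have "sym_vertex_boundary V E A \<subseteq> V"
    using assms(2) by (auto simp: sym_vertex_boundary_eq inner_boundary_def outer_boundary_def)
  ultimately show ?thesis using aut_card_image[OF assms(1)] by simp
qed

lemma card_sym_vertex_boundary_diff:
  assumes "A \<subseteq> V" "B \<subseteq> V"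
  shows "card (sym_vertex_boundary V E (A - B)) \<le> card (sym_vertex_boundary V E A) + card (sym_vertex_boundary V E B)"
proof -
  \<comment> \<open>A vertex of \<open>A - B\<close> with a neighbour in \<open>B\<close> lies just
    outside \<open>B\<close>, so \<open>B\<close> contributes with its inner and outer boundaries
    exchanged.\<close>
  have inner: "inner_boundary V E (A - B) \<subseteq> inner_boundary V E A \<union> outer_boundary V E B"
    using assms by (auto simp: inner_boundary_def outer_boundary_def insert_commute)
  have outer: "outer_boundary V E (A - B) \<subseteq> outer_boundary V E A \<union> inner_boundary V E B"
    using assms by (auto simp: inner_boundary_def outer_boundary_def insert_commute)
  have "card (sym_vertex_boundary V E (A - B)) \<le> card (sym_vertex_boundary V E A \<union> sym_vertex_boundary V E B)"
    using inner outer finite_inner_outer_boundary[OF assms(1)] finite_inner_outer_boundary[OF assms(2)]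
    by (intro card_mono) (auto simp: sym_vertex_boundary_eq)
  also have "\<dots> \<le> card (sym_vertex_boundary V E A) + card (sym_vertex_boundary V E B)" by (rule card_Un_le)
  finally show ?thesis .
qed

section \<open>The inequalities for the two isoperimetric constants\<close>

lemma edge_isoperimetric_step:
  assumes "2 \<le> n" "n + 1 \<le> card V"
  shows "edge_isoperimetric V E (n + 1) / (10 * real n + edge_isoperimetric V E (n + 1))
    \<le> edge_isoperimetric V E n"
proof -
  have eq: "edge_isoperimetric V E m = isoperimetric (\<lambda>A. card (edge_boundary V E A)) V m" for m
    by (simp add: edge_isoperimetric_def isoperimetric_def)
  have "1 * edge_isoperimetric V E (n + 1) / (10 * 1 * real n + edge_isoperimetric V E (n + 1))
    \<le> edge_isoperimetric V E n"
    unfolding eq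
  proof (rule isoperimetric_step[OF assms zero_less_one card_edge_boundary_aut card_edge_boundary_diff])
    fix A and t :: real
    assume "t \<le> card (inner_boundary V E A)"
    then show "1 * t \<le> card (edge_boundary V E A)" using card_inner_boundary_le[of A] by linarith
  qed
  then show ?thesis by (simp only: mult_1 mult_1_right)
qed

lemma vertex_isoperimetric_eq:
  "vertex_isoperimetric V E n = isoperimetric (\<lambda>A. card (sym_vertex_boundary V E A)) V n"
  by (simp add: vertex_isoperimetric_def isoperimetric_def)

lemma vertex_isoperimetric_step:
  assumes "2 \<le> n" "n + 1 \<le> card V"
  shows "2 * vertex_isoperimetric V E (n + 1) / (20 * real n + vertex_isoperimetric V E (n + 1))
    \<le> vertex_isoperimetric V E n"
proof -
  have "2 * vertex_isoperimetric V E (n + 1) / (10 * 2 * real n + vertex_isoperimetric V E (n + 1))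
    \<le> vertex_isoperimetric V E n"
    unfolding vertex_isoperimetric_eq
  proof (rule isoperimetric_step[OF assms zero_less_numeral card_sym_vertex_boundary_aut
        card_sym_vertex_boundary_diff])
    fix A and t :: real
    assume "A \<subseteq> V" "t \<le> card (inner_boundary V E A)" "t \<le> card (outer_boundary V E A)"
    then show "2 * t \<le> card (sym_vertex_boundary V E A)" by (simp add: card_sym_vertex_boundary)
  qed
  then show ?thesis by simp
qed

lemma vertex_isoperimetric_nonneg:
  "0 < n \<Longrightarrow> n \<le> card V \<Longrightarrow> 0 \<le> vertex_isoperimetric V E n"
  unfolding vertex_isoperimetric_eq by (rule isoperimetric_nonneg[OF finite_V])

text \<open>In a balanced partition every part has at least q = \<open>card V div n\<close> \<ge> 1
  vertices, and no boundary exceeds |V| \<le> nq + n \<le> 2nq.\<close>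

lemma vertex_isoperimetric_le:
  assumes "0 < n" "n \<le> card V"
  shows "vertex_isoperimetric V E n \<le> 2 * n"
proof -
  obtain P where P: "P \<in> n_partitions V n" "\<And>A. A \<in> P \<Longrightarrow> card V div n \<le> card A"
    using balanced_partition_exists[OF finite_V assms] by blast
  have q: "1 \<le> card V div n" using assms by (simp add: Suc_le_eq div_greater_zero_iff)
  show ?thesis unfolding vertex_isoperimetric_eq
  proof (rule isoperimetric_le[OF finite_V assms(1) P(1)])
    fix A assume A: "A \<in> P"
    then have "A \<subseteq> V" using P(1) by (auto simp: n_partitions_def partition_on_def)
    then have "sym_vertex_boundary V E A \<subseteq> V"
      by (auto simp: sym_vertex_boundary_eq inner_boundary_def outer_boundary_def)
    then have "card (sym_vertex_boundary V E A) \<le> card V" by (rule card_mono[OF finite_V])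
    also have "\<dots> \<le> n * (card V div n) + n"
      using mod_less_divisor[OF assms(1), of "card V"] mult_div_mod_eq[of n "card V"] by linarith
    also have "\<dots> \<le> 2 * n * (card V div n)" using mult_le_mono2[OF q, of n] by simp
    also have "\<dots> \<le> 2 * n * card A" by (rule mult_le_mono2) (rule P(2)[OF A])
    finally have "real (card (sym_vertex_boundary V E A)) \<le> 2 * n * card A"
      by (metis of_nat_mono)
    moreover have "0 < card A" using P(2)[OF A] q by simp
    ultimately show "real (card (sym_vertex_boundary V E A)) / real (card A) \<le> real (2 * n)"
      by (simp add: pos_divide_le_eq)
  qed
qed

text \<open>Clear the denominator in the previous inequality and insert the a priori bound 2(n + 1)
  for the constant with n + 1 parts: 20n + 2n + 2 is twice 11n + 1.\<close>

lemma vertex_isoperimetric_linear: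
  assumes "2 \<le> n" "n + 1 \<le> card V"
  shows "vertex_isoperimetric V E (n + 1) \<le> (11 * real n + 1) * vertex_isoperimetric V E n"
proof -
  let ?i = "vertex_isoperimetric V E n" and ?j = "vertex_isoperimetric V E (n + 1)"
  have i: "0 \<le> ?i" and j: "0 \<le> ?j" "?j \<le> 2 * real n + 2"
    using vertex_isoperimetric_nonneg[of n] vertex_isoperimetric_nonneg[of "n + 1"]
      vertex_isoperimetric_le[of "n + 1"] assms by auto
  have "0 < 20 * real n + ?j" using j assms by linarith
  then have "2 * ?j \<le> ?i * (20 * real n + ?j)"
    using vertex_isoperimetric_step[OF assms] by (simp only: pos_divide_le_eq)
  also have "\<dots> \<le> ?i * (20 * real n + (2 * real n + 2))" using i j by (intro mult_left_mono) auto
  finally show ?thesis by (simp add: algebra_simps)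
qed

end

theorem mainTheorem1:
  fixes V :: "'a set" and E :: "'a set set" and n :: nat
  assumes "simple_graph V E" and "regular_graph V E"
    and "connected_graph V E" and "vertex_transitive V E"
    and "2 \<le> n" and "n \<le> card V - 1"
  shows "edge_isoperimetric V E n
           \<ge> edge_isoperimetric V E (n + 1) / (10 * real n + edge_isoperimetric V E (n + 1))
       \<and> vertex_isoperimetric V E n
           \<ge> 2 * vertex_isoperimetric V E (n + 1) / (20 * real n + vertex_isoperimetric V E (n + 1))
       \<and> vertex_isoperimetric V E (n + 1) \<le> (11 * real n + 1) * vertex_isoperimetric V E n"
proof -
  interpret transitive_graph V E using assms by unfold_locales
  \<comment> \<open>The subtraction is truncated, but 2 \<le> n rules out
    \<open>card V = 0\<close>.\<close>
  have "n + 1 \<le> card V" using assms(5,6) by linarith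
  then show ?thesis
    using edge_isoperimetric_step vertex_isoperimetric_step vertex_isoperimetric_linear assms(5) by blast
qed

end
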